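(* Let $q>0$ be an integer, let $X$ be a finite $(q+1)$-regular graph with $n$ vertices, fix a base vertex $x_0$ of $X$, and let $x$ be any vertex of $X$. Let $\lambda_0\le\lambda_1\le\dots\le\lambda_{n-1}$ be the eigenvalues of the Laplacian $\Delta$ of $X$ (with multiplicity) and let $f_0,\dots,f_{n-1}$ be corresponding eigenfunctions, orthonormal with respect to the inner product $\frac1n\sum_{v\in VX} f(v)\overline{g(v)}$. Define the two-variable zeta function by $$\log\zeta_X(u,x)=\sum_{m=1}^\infty\frac{b_m(x)}{m}u^m .$$ Then, for all $u$ with $|u|$ sufficiently small, $$-\log\zeta_X(u,x)=\frac1n\sum_{j=0}^{n-1}f_j(x)\overline{f_j(x_0)}\,\log\bigl(1-(q+1-\lambda_j)u+qu^2\bigr).$$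
   Context: A graph $X$ consists of a set $VX$ of vertices, a set $EX$ of (oriented) edges, maps $o,t:EX\to VX$ (origin and terminus), and a map $y\mapsto\overline{y}$ on $EX$ with $\overline{\overline{y}}=y$, $\overline{y}\ne y$, $o(y)=t(\overline{y})$ for all $y\in EX$ (loops and multiple edges are allowed). The degree of a vertex $x$ is the number of $y\in EX$ with $o(y)=x$; $X$ is $d$-regular if every vertex has degree $d$. A path of length $k\ge 1$ from $x_0$ to $x$ is a sequence of edges $y_0,\dots,y_{k-1}$ with $o(y_0)=x_0$, $t(y_i)=o(y_{i+1})$ and $t(y_{k-1})=x$; a path of length $0$ is a single vertex. A path has backtracking if $y_{i+1}=\overline{y_i}$ for some $i$. A geodesic is a path without backtracking. Let $c_m(x)$ be the number of geodesics of length $m$ from $x_0$ to $x$ (so $c_0(x)=1$ if $x=x_0$ and $c_0(x)=0$ otherwise), and $b_m(x)=c_m(x)-(q-1)(c_{m-2}(x)+c_{m-4}(x)+\cdots)$, where the last term in the parenthesis is $c_1(x)$ if $m$ is odd and $c_0(x)$ if $m$ is even ($b_0(x)=c_0(x)$, $b_1(x)=c_1(x)$). The Laplacian on functions $f$ on $VX$ is $\Delta f(x)=(q+1)f(x)-\sum_{e:\,o(e)=x} f(t(e))$. The logarithm is the principal branch. *)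

theory Defs
  imports
    "HOL-Analysis.Analysis"
    "Graph_Theory.Digraph"
    "Graph_Theory.Bidirected_Digraph"
    "Graph_Theory.Arc_Walk"
begin

text \<open>
  Graphs in the sense of Serre are instances of \<^locale>\<open>bidirected_digraph\<close>: \<open>arcs G\<close> is the
  set of oriented edges, \<open>tail\<close> is the origin, \<open>head\<close> the terminus, and \<open>arev\<close> is the
  fixed-point-free involution reversing edges (by the library's convention it is the identity
  off \<open>arcs G\<close>). Loops and multiple edges are allowed; connectedness is not assumed.
\<close>

definition regular_graph :: "nat \<Rightarrow> ('a, 'b) pre_digraph \<Rightarrow> bool" where
  "regular_graph d G \<longleftrightarrow> (\<forall>v\<in>verts G. out_degree G v = d)"

definition backtracking :: "('b \<Rightarrow> 'b) \<Rightarrow> 'b list \<Rightarrow> bool" where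
  "backtracking arev p \<longleftrightarrow> (\<exists>i. Suc i < length p \<and> p ! Suc i = arev (p ! i))"

definition geodesics ::
  "('a, 'b) pre_digraph \<Rightarrow> ('b \<Rightarrow> 'b) \<Rightarrow> nat \<Rightarrow> 'a \<Rightarrow> 'a \<Rightarrow> 'b list set" where
  "geodesics G arev m x0 x =
     {p. pre_digraph.awalk G x0 p x \<and> length p = m \<and> \<not> backtracking arev p}"

definition geo_count ::
  "('a, 'b) pre_digraph \<Rightarrow> ('b \<Rightarrow> 'b) \<Rightarrow> 'a \<Rightarrow> nat \<Rightarrow> 'a \<Rightarrow> nat" where
  "geo_count G arev x0 m x = card (geodesics G arev m x0 x)"

definition zeta_coeff ::
  "('a, 'b) pre_digraph \<Rightarrow> ('b \<Rightarrow> 'b) \<Rightarrow> nat \<Rightarrow> 'a \<Rightarrow> nat \<Rightarrow> 'a \<Rightarrow> int" where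
  "zeta_coeff G arev q x0 m x =
     int (geo_count G arev x0 m x)
       - (int q - 1) * (\<Sum>k = 1..m div 2. int (geo_count G arev x0 (m - 2 * k) x))"

definition log_zeta_term ::
  "('a, 'b) pre_digraph \<Rightarrow> ('b \<Rightarrow> 'b) \<Rightarrow> nat \<Rightarrow> 'a \<Rightarrow> complex \<Rightarrow> 'a \<Rightarrow> nat \<Rightarrow> complex" where
  "log_zeta_term G arev q x0 u x m = of_int (zeta_coeff G arev q x0 m x) / of_nat m * u ^ m"

text \<open>
  The series prescribes the logarithm of the zeta function, so the function itself is the
  exponential of its sum (meaningful where the series converges).
\<close>

definition graph_zeta ::
  "('a, 'b) pre_digraph \<Rightarrow> ('b \<Rightarrow> 'b) \<Rightarrow> nat \<Rightarrow> 'a \<Rightarrow> complex \<Rightarrow> 'a \<Rightarrow> complex" where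
  "graph_zeta G arev q x0 u x = exp (\<Sum>m. log_zeta_term G arev q x0 u x (Suc m))"

definition laplacian ::
  "('a, 'b) pre_digraph \<Rightarrow> nat \<Rightarrow> ('a \<Rightarrow> complex) \<Rightarrow> 'a \<Rightarrow> complex" where
  "laplacian G q f v = (of_nat q + 1) * f v - (\<Sum>e\<in>out_arcs G v. f (head G e))"

text \<open>Functions on the vertex set are total functions whose values off \<open>verts G\<close> are ignored.\<close>

definition laplacian_eigenfunction ::
  "('a, 'b) pre_digraph \<Rightarrow> nat \<Rightarrow> real \<Rightarrow> ('a \<Rightarrow> complex) \<Rightarrow> bool" where
  "laplacian_eigenfunction G q \<mu> f \<longleftrightarrow>
     (\<exists>v\<in>verts G. f v \<noteq> 0) \<and> (\<forall>v\<in>verts G. laplacian G q f v = of_real \<mu> * f v)"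

definition vertex_inner ::
  "('a, 'b) pre_digraph \<Rightarrow> ('a \<Rightarrow> complex) \<Rightarrow> ('a \<Rightarrow> complex) \<Rightarrow> complex" where
  "vertex_inner G f g = (\<Sum>v\<in>verts G. f v * cnj (g v)) / of_nat (card (verts G))"

text \<open>
  Since there are as many orthonormal eigenfunctions as vertices, they form a basis of the space
  of functions on the vertices; hence \<open>lam 0, \<dots>, lam (n - 1)\<close> are all the eigenvalues of the
  Laplacian, each listed as often as its multiplicity.
\<close>

definition orthonormal_eigensystem ::
  "('a, 'b) pre_digraph \<Rightarrow> nat \<Rightarrow> (nat \<Rightarrow> real) \<Rightarrow> (nat \<Rightarrow> 'a \<Rightarrow> complex) \<Rightarrow> bool" where
  "orthonormal_eigensystem G q lam f \<longleftrightarrow>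
     (let n = card (verts G) in
        (\<forall>i j. i \<le> j \<longrightarrow> j < n \<longrightarrow> lam i \<le> lam j) \<and>
        (\<forall>j<n. laplacian_eigenfunction G q (lam j) (f j)) \<and>
        (\<forall>i<n. \<forall>j<n. vertex_inner G (f i) (f j) = (if i = j then 1 else 0)))"

end

theory Submission
  imports Defs
begin

text \<open>
  Let \<open>A\<close> be the adjacency operator of \<open>G\<close>, so that \<open>\<Delta> = q + 1 - A\<close>. Removing the first edge of a
  geodesic gives, for the counts \<open>c\<^bsub>m\<^esub>\<close> as functions of the starting point, the recurrence
  \<open>c\<^bsub>m+2\<^esub> = A c\<^bsub>m+1\<^esub> - q c\<^bsub>m\<^esub>\<close> for \<open>m > 0\<close>, with \<open>q + 1\<close> in place of \<open>q\<close> at \<open>m = 0\<close>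
  (\<open>geo_count_recurrence\<close>). Hence \<open>c\<^bsub>m\<^esub>\<close> is a polynomial in \<open>A\<close> applied to the delta function at the
  endpoint. That delta function expands in the eigenbasis (\<open>orthonormal_complete\<close>), so the counts
  are spectral sums over the eigenvalues \<open>\<mu>\<^bsub>j\<^esub> = q + 1 - \<lambda>\<^bsub>j\<^esub>\<close> of \<open>A\<close> (\<open>geo_count_spectral\<close>).

  Factor \<open>1 - \<mu> u + q u^2 = (1 - \<alpha> u) (1 - \<beta> u)\<close>. The correction in the definition of \<open>b\<^bsub>m\<^esub>\<close> is
  designed to cancel the irregular start of the recurrence: what it leaves at each eigenvalue is
  the power sum \<open>\<alpha>^m + \<beta>^m\<close> for \<open>m > 0\<close> (\<open>zeta_coeff_poly_eq_power_sum\<close>). Dividing by \<open>m\<close> and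
  summing against \<open>u^m\<close> gives \<open>- Ln (1 - \<alpha> u) - Ln (1 - \<beta> u)\<close>. For small \<open>u\<close> the principal
  logarithms add up to that of the product (\<open>power_sum_series\<close>), and the sum of the series lies in
  the strip where \<open>Ln\<close> inverts the exponential that defines the zeta function.
\<close>

section \<open>Counting geodesics by their first edge\<close>

locale fin_bidirected_digraph = bidirected_digraph G arev + fin_digraph G
  for G :: "('a, 'b) pre_digraph" and arev :: "'b \<Rightarrow> 'b"
begin

definition geodesics_via :: "nat \<Rightarrow> 'b \<Rightarrow> 'a \<Rightarrow> 'b list set" where
  "geodesics_via m e x = {p \<in> geodesics G arev m (tail G e) x. p \<noteq> [] \<and> hd p = e}"

lemma finite_geodesics: "finite (geodesics G arev m v x)"
proof (rule finite_subset)
  show "geodesics G arev m v x \<subseteq> {p. set p \<subseteq> arcs G \<and> length p = m}"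
    by (auto simp: geodesics_def awalk_def)
qed (simp add: finite_lists_length_eq)

lemma geodesics_via_0: "geodesics_via 0 e x = {}"
  by (auto simp: geodesics_via_def geodesics_def)

lemma backtracking_Cons:
  "backtracking arev (e # p) \<longleftrightarrow> (p \<noteq> [] \<and> hd p = arev e) \<or> backtracking arev p"
proof
  assume "backtracking arev (e # p)"
  then obtain i where "Suc i < length (e # p)" "(e # p) ! Suc i = arev ((e # p) ! i)"
    unfolding backtracking_def by blast
  then show "(p \<noteq> [] \<and> hd p = arev e) \<or> backtracking arev p"
    by (cases i) (auto simp: backtracking_def hd_conv_nth)
next
  assume "(p \<noteq> [] \<and> hd p = arev e) \<or> backtracking arev p"
  then show "backtracking arev (e # p)"
  proof
    assume "p \<noteq> [] \<and> hd p = arev e"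
    then show ?thesis
      by (auto simp: backtracking_def hd_conv_nth intro!: exI[of _ 0])
  next
    assume "backtracking arev p"
    then obtain i where "Suc i < length p" "p ! Suc i = arev (p ! i)"
      unfolding backtracking_def by blast
    then show ?thesis
      by (auto simp: backtracking_def intro!: exI[of _ "Suc i"])
  qed
qed

lemma geodesics_via_Suc:
  assumes "e \<in> arcs G"
  shows "geodesics_via (Suc m) e x =
    (#) e ` (geodesics G arev m (head G e) x - geodesics_via m (arev e) x)" (is "?L = ?R")
proof (rule set_eqI)
  fix p
  show "p \<in> ?L \<longleftrightarrow> p \<in> ?R"
    using assms
    by (cases p) (auto simp: geodesics_via_def geodesics_def backtracking_Cons awalk_Cons_iff)
qed

text \<open>
  A geodesic may be prolonged backwards by \<open>e\<close> exactly when it does not start with the reverse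
  of \<open>e\<close>.
\<close>

lemma card_geodesics_via_Suc:
  assumes "e \<in> arcs G"
  shows "card (geodesics_via (Suc m) e x) + card (geodesics_via m (arev e) x) =
    geo_count G arev (head G e) m x"
proof -
  have sub: "geodesics_via m (arev e) x \<subseteq> geodesics G arev m (head G e) x"
    using assms by (auto simp: geodesics_via_def)
  have "card (geodesics_via (Suc m) e x) =
      card (geodesics G arev m (head G e) x - geodesics_via m (arev e) x)"
    by (simp add: geodesics_via_Suc[OF assms] card_image)
  also have "\<dots> = geo_count G arev (head G e) m x - card (geodesics_via m (arev e) x)"
    unfolding geo_count_def
    using sub finite_geodesics by (intro card_Diff_subset) (auto intro: finite_subset)
  finally show ?thesis
    using card_mono[OF finite_geodesics sub] by (simp add: geo_count_def)
qed

lemma geo_count_eq_sum_via: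
  "geo_count G arev v (Suc m) x = (\<Sum>e\<in>out_arcs G v. card (geodesics_via (Suc m) e x))"
proof -
  have eq: "geodesics G arev (Suc m) v x = (\<Union>e\<in>out_arcs G v. geodesics_via (Suc m) e x)"
  proof (rule set_eqI)
    fix p
    show "p \<in> geodesics G arev (Suc m) v x \<longleftrightarrow>
        p \<in> (\<Union>e\<in>out_arcs G v. geodesics_via (Suc m) e x)"
      by (cases p) (auto simp: geodesics_via_def geodesics_def awalk_Cons_iff)
  qed
  show ?thesis
    unfolding geo_count_def eq
  proof (rule card_UN_disjoint)
    show "\<forall>e\<in>out_arcs G v. finite (geodesics_via (Suc m) e x)"
      using finite_geodesics by (auto simp: geodesics_via_def)
  qed (auto simp: geodesics_via_def)
qed

lemma geo_count_0:
  assumes "v \<in> verts G"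
  shows "geo_count G arev v 0 x = (if v = x then 1 else 0)"
proof -
  have "geodesics G arev 0 v x = (if v = x then {[]} else {})"
    using assms by (auto simp: geodesics_def awalk_Nil_iff backtracking_def)
  then show ?thesis by (simp add: geo_count_def)
qed

lemma geo_count_1:
  "geo_count G arev v (Suc 0) x = (\<Sum>e\<in>out_arcs G v. geo_count G arev (head G e) 0 x)"
  unfolding geo_count_eq_sum_via
proof (rule sum.cong[OF refl])
  fix e assume "e \<in> out_arcs G v"
  then show "card (geodesics_via (Suc 0) e x) = geo_count G arev (head G e) 0 x"
    using card_geodesics_via_Suc[of e 0 x] by (simp add: geodesics_via_0)
qed

text \<open>
  Putting an edge \<open>e\<close> from \<open>v\<close> in front of a geodesic of length \<open>m + 1\<close> fails to give a geodesic
  when the latter begins by retracing \<open>e\<close>. Dropping the retraced edge then leaves a geodesic of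
  length \<open>m\<close> from \<open>v\<close> that does not start with \<open>e\<close>. Each such geodesic arises from all edges at \<open>v\<close>
  but its first one, that is, from \<open>q\<close> of them; the empty geodesic has no first edge and arises
  from all \<open>q + 1\<close>.
\<close>

lemma geo_count_recurrence:
  assumes reg: "regular_graph (q + 1) G" and v: "v \<in> verts G"
  shows "geo_count G arev v (Suc (Suc m)) x + (if m = 0 then q + 1 else q) * geo_count G arev v m x
    = (\<Sum>e\<in>out_arcs G v. geo_count G arev (head G e) (Suc m) x)"
proof -
  let ?g = "geo_count G arev" and ?h = "\<lambda>k e. card (geodesics_via k e x)"
  have deg: "card (out_arcs G v) = q + 1"
    using reg v by (simp add: regular_graph_def out_degree_def)
  have "(\<Sum>e\<in>out_arcs G v. ?h (Suc m) (arev e)) + (\<Sum>e\<in>out_arcs G v. ?h m e)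
      = (\<Sum>e\<in>out_arcs G v. ?g v m x)"
    unfolding sum.distrib[symmetric]
  proof (rule sum.cong[OF refl])
    fix e assume "e \<in> out_arcs G v"
    then show "?h (Suc m) (arev e) + ?h m e = ?g v m x"
      using card_geodesics_via_Suc[of "arev e" m x] by simp
  qed
  then have rev: "(\<Sum>e\<in>out_arcs G v. ?h (Suc m) (arev e)) + (\<Sum>e\<in>out_arcs G v. ?h m e)
      = (q + 1) * ?g v m x"
    by (simp only: sum_constant deg of_nat_id)
  have start: "(\<Sum>e\<in>out_arcs G v. ?h m e) = (if m = 0 then 0 else ?g v m x)"
    by (cases m) (simp_all add: geodesics_via_0 geo_count_eq_sum_via)
  have "(\<Sum>e\<in>out_arcs G v. ?g (head G e) (Suc m) x) =
      (\<Sum>e\<in>out_arcs G v. ?h (Suc (Suc m)) e + ?h (Suc m) (arev e))"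
    by (rule sum.cong[OF refl]) (simp add: card_geodesics_via_Suc)
  also have "\<dots> = ?g v (Suc (Suc m)) x + (\<Sum>e\<in>out_arcs G v. ?h (Suc m) (arev e))"
    by (simp add: sum.distrib geo_count_eq_sum_via)
  finally show ?thesis
    using rev start by (auto split: if_splits)
qed

end

section \<open>Spectral expansion of the geodesic counts\<close>

text \<open>
  The kernel \<open>P\<close> formed by the left-hand sides is \<open>n\<close> times an orthogonal projection, and its trace
  equals that of \<open>n\<close> times the identity. The difference \<open>D\<close> of the two is thus \<open>n\<close> times a projection
  of trace zero, and it vanishes because its squared Hilbert--Schmidt norm is \<open>n\<close> times its trace.
\<close>

lemma orthonormal_complete:
  fixes f :: "nat \<Rightarrow> 'a \<Rightarrow> complex"
  assumes fin: "finite V" and n: "n = card V"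
    and orth: "\<And>i j. i < n \<Longrightarrow> j < n \<Longrightarrow>
      (\<Sum>v\<in>V. f i v * cnj (f j v)) = (if i = j then of_nat n else 0)"
    and "v \<in> V" and "w \<in> V"
  shows "(\<Sum>j<n. f j v * cnj (f j w)) = (if v = w then of_nat n else 0)"
proof -
  define P where "P = (\<lambda>v w. \<Sum>j<n. f j v * cnj (f j w))"
  define D where "D = (\<lambda>v w. (if v = w then of_nat n else 0) - P v w)"
  have P_real: "cnj (P v v) = P v v" for v
    by (simp add: P_def mult.commute)
  have PP: "(\<Sum>w\<in>V. P v w * cnj (P v w)) = of_nat n * P v v" for v
  proof -
    have "(\<Sum>w\<in>V. P v w * cnj (P v w)) =
        (\<Sum>w\<in>V. \<Sum>i<n. \<Sum>j<n. f i v * cnj (f j v) * (f j w * cnj (f i w)))"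
      unfolding P_def cnj_sum sum_product by (intro sum.cong refl) simp
    also have "\<dots> = (\<Sum>i<n. \<Sum>w\<in>V. \<Sum>j<n. f i v * cnj (f j v) * (f j w * cnj (f i w)))"
      by (rule sum.swap)
    also have "\<dots> = (\<Sum>i<n. \<Sum>j<n. \<Sum>w\<in>V. f i v * cnj (f j v) * (f j w * cnj (f i w)))"
      by (intro sum.cong refl sum.swap)
    also have "\<dots> = (\<Sum>i<n. \<Sum>j<n. f i v * cnj (f j v) * (if j = i then of_nat n else 0))"
      by (intro sum.cong refl) (simp add: sum_distrib_left[symmetric] orth)
    also have "\<dots> = (\<Sum>i<n. f i v * cnj (f i v) * of_nat n)"
      by (intro sum.cong refl) (simp add: if_distrib[of "\<lambda>c. _ * c"] cong: if_cong)
    also have "\<dots> = of_nat n * P v v"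
      by (simp add: P_def sum_distrib_left mult_ac)
    finally show ?thesis .
  qed
  have DD: "(\<Sum>w\<in>V. D v w * cnj (D v w)) = of_nat n * (of_nat n - P v v)" if "v \<in> V" for v
  proof -
    have "(\<Sum>w\<in>V. D v w * cnj (D v w)) =
       (\<Sum>w\<in>V. (if v = w then of_nat n * (of_nat n - P v w - cnj (P v w)) else 0)
          + P v w * cnj (P v w))"
      by (rule sum.cong) (auto simp: D_def algebra_simps)
    also have "\<dots> = of_nat n * (of_nat n - P v v)"
      using that fin by (simp add: sum.distrib PP P_real algebra_simps)
    finally show ?thesis .
  qed
  have trace: "(\<Sum>v\<in>V. P v v) = of_nat n * of_nat n"
  proof -
    have "(\<Sum>v\<in>V. P v v) = (\<Sum>j<n. \<Sum>v\<in>V. f j v * cnj (f j v))"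
      unfolding P_def by (rule sum.swap)
    then show ?thesis by (simp add: orth)
  qed
  have "(\<Sum>v\<in>V. \<Sum>w\<in>V. D v w * cnj (D v w)) = 0"
    using n by (simp add: DD sum_distrib_left[symmetric] sum_subtractf trace)
  then have "complex_of_real (\<Sum>v\<in>V. \<Sum>w\<in>V. (cmod (D v w))\<^sup>2) = 0"
    by (simp only: complex_norm_square of_real_sum)
  then have "(\<Sum>v\<in>V. \<Sum>w\<in>V. (cmod (D v w))\<^sup>2) = 0"
    by (simp only: of_real_eq_0_iff)
  then have "D v w = 0"
    using assms(4,5) fin by (simp add: sum_nonneg_eq_0_iff sum_nonneg)
  then show ?thesis by (simp add: D_def P_def)
qed

text \<open>
  These polynomials send the adjacency operator of a \<open>(q + 1)\<close>-regular graph to the operators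
  counting geodesics of a given length.
\<close>

fun geo_poly :: "nat \<Rightarrow> complex \<Rightarrow> nat \<Rightarrow> complex" where
  "geo_poly q \<mu> 0 = 1"
| "geo_poly q \<mu> (Suc 0) = \<mu>"
| "geo_poly q \<mu> (Suc (Suc m)) =
     \<mu> * geo_poly q \<mu> (Suc m) - (if m = 0 then of_nat q + 1 else of_nat q) * geo_poly q \<mu> m"

text \<open>
  The counts are expanded as functions of the starting point \<open>v\<close>, because the recurrence moves
  that point. Their expansion then uses the conjugate functions, which are eigenfunctions
  for the same eigenvalues since these are real.
\<close>

lemma (in fin_bidirected_digraph) geo_count_spectral:
  assumes reg: "regular_graph (q + 1) G" and n: "n = card (verts G)"
    and eig: "orthonormal_eigensystem G q lam f" and x: "x \<in> verts G"
  shows "v \<in> verts G \<Longrightarrow> of_nat (geo_count G arev v m x) =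
    1 / of_nat n * (\<Sum>j<n. f j x * cnj (f j v) * geo_poly q (of_nat q + 1 - of_real (lam j)) m)"
proof -
  define \<mu> where "\<mu> = (\<lambda>j. of_nat q + 1 - complex_of_real (lam j))"
  define S where "S = (\<lambda>m v. 1 / of_nat n * (\<Sum>j<n. f j x * cnj (f j v) * geo_poly q (\<mu> j) m))"
  have n0: "n \<noteq> 0" using x n by auto
  have orth: "(\<Sum>v\<in>verts G. f i v * cnj (f j v)) = (if i = j then of_nat n else 0)"
    if "i < n" "j < n" for i j
  proof -
    have "vertex_inner G (f i) (f j) = (if i = j then 1 else 0)"
      using eig that n by (auto simp: orthonormal_eigensystem_def Let_def)
    then show ?thesis
      using n0 n by (auto simp: vertex_inner_def split: if_splits)
  qed
  have adj: "(\<Sum>e\<in>out_arcs G v. cnj (f j (head G e))) = \<mu> j * cnj (f j v)"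
    if "v \<in> verts G" "j < n" for v j
  proof -
    have "laplacian G q (f j) v = of_real (lam j) * f j v"
      using eig that n
      by (auto simp: orthonormal_eigensystem_def Let_def laplacian_eigenfunction_def)
    then have "(\<Sum>e\<in>out_arcs G v. f j (head G e)) = \<mu> j * f j v"
      by (simp add: laplacian_def \<mu>_def algebra_simps)
    then have "cnj (\<Sum>e\<in>out_arcs G v. f j (head G e)) = cnj (\<mu> j * f j v)"
      by simp
    then show ?thesis by (simp add: \<mu>_def)
  qed
  have adjS: "(\<Sum>e\<in>out_arcs G v. S m (head G e)) =
      1 / of_nat n * (\<Sum>j<n. f j x * cnj (f j v) * (\<mu> j * geo_poly q (\<mu> j) m))"
    if v: "v \<in> verts G" for v m
  proof -
    have "(\<Sum>e\<in>out_arcs G v. S m (head G e)) = 1 / of_nat n *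
        (\<Sum>j<n. \<Sum>e\<in>out_arcs G v. f j x * cnj (f j (head G e)) * geo_poly q (\<mu> j) m)"
      unfolding S_def sum_distrib_left[symmetric] by (subst sum.swap) (rule refl)
    also have "(\<Sum>j<n. \<Sum>e\<in>out_arcs G v. f j x * cnj (f j (head G e)) * geo_poly q (\<mu> j) m)
        = (\<Sum>j<n. f j x * (\<Sum>e\<in>out_arcs G v. cnj (f j (head G e))) * geo_poly q (\<mu> j) m)"
      by (simp add: sum_distrib_left sum_distrib_right)
    also have "\<dots> = (\<Sum>j<n. f j x * cnj (f j v) * (\<mu> j * geo_poly q (\<mu> j) m))"
      using v by (intro sum.cong refl) (simp add: adj)
    finally show ?thesis .
  qed
  have start: "of_nat (geo_count G arev v 0 x) = S 0 v" if v: "v \<in> verts G" for v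
  proof -
    have "(\<Sum>j<n. f j x * cnj (f j v)) = (if x = v then of_nat n else 0)"
      using orthonormal_complete[OF _ n orth x v] by simp
    then show ?thesis
      using v n0 by (simp add: geo_count_0 S_def)
  qed
  have "of_nat (geo_count G arev v m x) = S m v" if "v \<in> verts G" for v
    using that
  proof (induction m arbitrary: v rule: induct_nat_012)
    case 0
    then show ?case by (rule start)
  next
    case 1
    have "of_nat (geo_count G arev v (Suc 0) x) = (\<Sum>e\<in>out_arcs G v. S 0 (head G e))"
      by (simp add: geo_count_1 start)
    also have "\<dots> = S (Suc 0) v"
      unfolding adjS[OF 1] by (simp add: S_def)
    finally show ?case .
  next
    case (ge2 m)
    let ?c = "if m = 0 then of_nat q + 1 else of_nat q :: complex"
    have "complex_of_nat (geo_count G arev v (Suc (Suc m)) x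
         + (if m = 0 then q + 1 else q) * geo_count G arev v m x)
      = of_nat (\<Sum>e\<in>out_arcs G v. geo_count G arev (head G e) (Suc m) x)"
      using geo_count_recurrence[OF reg ge2(3)] by simp
    then have "of_nat (geo_count G arev v (Suc (Suc m)) x) =
        (\<Sum>e\<in>out_arcs G v. S (Suc m) (head G e)) - ?c * S m v"
      using ge2 by (cases "m = 0") (simp_all add: algebra_simps)
    also have "\<dots> = S (Suc (Suc m)) v"
      by (simp only: adjS[OF ge2(3)])
        (simp add: S_def sum_distrib_left sum_subtractf[symmetric] diff_divide_distrib
          algebra_simps)
    finally show ?case .
  qed
  then show "v \<in> verts G \<Longrightarrow> of_nat (geo_count G arev v m x) =
    1 / of_nat n * (\<Sum>j<n. f j x * cnj (f j v) * geo_poly q (of_nat q + 1 - of_real (lam j)) m)"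
    by (simp add: S_def \<mu>_def)
qed

section \<open>The corrected coefficients are power sums\<close>

lemma geo_poly_diff:
  assumes "\<alpha> + \<beta> = \<mu>" and "\<alpha> * \<beta> = of_nat q"
  shows "geo_poly q \<mu> (m + 2) - of_nat q * geo_poly q \<mu> m =
    (\<alpha> ^ (m + 2) + \<beta> ^ (m + 2)) - (if m = 0 then 1 else \<alpha> ^ m + \<beta> ^ m)"
proof -
  define d where "d = (\<lambda>m. geo_poly q \<mu> (m + 2) - of_nat q * geo_poly q \<mu> m
     - (\<alpha> ^ (m + 2) + \<beta> ^ (m + 2)) + (if m = 0 then 1 else \<alpha> ^ m + \<beta> ^ m))"
  note q = assms(2)[symmetric] and \<mu> = assms(1)[symmetric]
  have rec: "d (Suc (Suc (Suc m))) = \<mu> * d (Suc (Suc m)) - of_nat q * d (Suc m)" for m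
    by (simp add: d_def q \<mu>) (simp add: algebra_simps)
  have "d m = 0 \<and> d (Suc m) = 0 \<and> d (Suc (Suc m)) = 0"
  proof (induction m)
    case 0
    show ?case
      by (simp add: d_def q \<mu> numeral_2_eq_2) (simp add: algebra_simps)
  next
    case (Suc m)
    then show ?case by (simp add: rec)
  qed
  then have "d m = 0" by blast
  then show ?thesis by (simp add: d_def algebra_simps)
qed

text \<open>
  Consecutive corrected coefficients of the same parity differ by \<open>c\<^bsub>m+2\<^esub> - q c\<^bsub>m\<^esub>\<close>, so the sum
  telescopes.
\<close>

lemma zeta_coeff_poly_eq_power_sum:
  assumes "\<alpha> + \<beta> = \<mu>" and "\<alpha> * \<beta> = of_nat q"
  shows "geo_poly q \<mu> m - (of_nat q - 1) * (\<Sum>k = 1..m div 2. geo_poly q \<mu> (m - 2 * k)) =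
    (if m = 0 then 1 else \<alpha> ^ m + \<beta> ^ m)"
proof (induction m rule: induct_nat_012)
  case (ge2 m)
  have "(\<Sum>k = 1..Suc (Suc m) div 2. geo_poly q \<mu> (Suc (Suc m) - 2 * k)) =
      geo_poly q \<mu> m + (\<Sum>k = 1..m div 2. geo_poly q \<mu> (m - 2 * k))"
    by (simp add: sum.shift_bounds_cl_Suc_ivl sum.atLeast_Suc_atMost[of 0] del: sum.cl_ivl_Suc)
  then have "geo_poly q \<mu> (Suc (Suc m)) - (of_nat q - 1) *
        (\<Sum>k = 1..Suc (Suc m) div 2. geo_poly q \<mu> (Suc (Suc m) - 2 * k)) =
      (geo_poly q \<mu> m - (of_nat q - 1) * (\<Sum>k = 1..m div 2. geo_poly q \<mu> (m - 2 * k)))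
        + (geo_poly q \<mu> (m + 2) - of_nat q * geo_poly q \<mu> m)"
    by (simp only: add_2_eq_Suc') (simp only: algebra_simps mult_1)
  also have "\<dots> = \<alpha> ^ (m + 2) + \<beta> ^ (m + 2)"
    by (simp only: ge2(1) geo_poly_diff[OF assms]) simp
  finally show ?case by simp
qed (use assms in auto)

section \<open>Summing the logarithmic series\<close>

lemma power_series_minus_Ln:
  assumes "norm (z::complex) < 1"
  shows "(\<lambda>m. z ^ Suc m / of_nat (Suc m)) sums - Ln (1 - z)"
proof -
  have "(\<lambda>m. - (z ^ m / of_nat m)) sums Ln (1 - z)"
    using Ln_series'[of "- z"] assms by simp
  then have "(\<lambda>m. z ^ m / of_nat m) sums - Ln (1 - z)"
    using sums_minus by fastforce
  then show ?thesis
    by (subst sums_Suc_iff) simp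
qed

lemma power_sum_series:
  assumes "norm (\<alpha> * u) < 1" and "norm (\<beta> * u) < (1::real)"
  shows "(\<lambda>m. (\<alpha> ^ Suc m + \<beta> ^ Suc m) / of_nat (Suc m) * u ^ Suc m) sums
    - Ln (1 - (\<alpha> + \<beta>) * u + \<alpha> * \<beta> * u ^ 2)"
proof -
  \<comment> \<open>Both factors lie in the right half-plane, so their arguments cannot add up past \<open>\<pi>\<close>.\<close>
  have half_plane: "\<bar>Im (Ln (1 - z))\<bar> < pi / 2" "1 - z \<noteq> 0" if "norm z < 1" for z :: complex
  proof -
    have "Re (1 - z) > 0"
      using that abs_Re_le_cmod[of z] by simp
    then show "\<bar>Im (Ln (1 - z))\<bar> < pi / 2" "1 - z \<noteq> 0"
      using Re_Ln_pos_lt_imp by auto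
  qed
  have "Ln ((1 - \<alpha> * u) * (1 - \<beta> * u)) = Ln (1 - \<alpha> * u) + Ln (1 - \<beta> * u)"
    using half_plane[OF assms(1)] half_plane[OF assms(2)]
    by (intro Ln_times_simple) auto
  moreover have "(1 - \<alpha> * u) * (1 - \<beta> * u) = 1 - (\<alpha> + \<beta>) * u + \<alpha> * \<beta> * u ^ 2"
    by (simp add: algebra_simps power2_eq_square)
  ultimately have Ln_split:
    "- Ln (1 - (\<alpha> + \<beta>) * u + \<alpha> * \<beta> * u ^ 2) = - Ln (1 - \<alpha> * u) + - Ln (1 - \<beta> * u)"
    by simp
  show ?thesis
    unfolding Ln_split
    using sums_add[OF power_series_minus_Ln[OF assms(1)] power_series_minus_Ln[OF assms(2)]]
    by (simp add: power_mult_distrib add_divide_distrib algebra_simps)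
qed

lemma exists_sum_product:
  fixes \<mu> c :: complex
  obtains \<alpha> \<beta> where "\<alpha> + \<beta> = \<mu>" "\<alpha> * \<beta> = c"
proof
  let ?s = "csqrt (\<mu>\<^sup>2 - 4 * c)"
  show "(\<mu> + ?s) / 2 + (\<mu> - ?s) / 2 = \<mu>"
    by (simp add: field_simps)
  have "(\<mu> + ?s) / 2 * ((\<mu> - ?s) / 2) = (\<mu>\<^sup>2 - ?s\<^sup>2) / 4"
    by (simp add: field_simps power2_eq_square)
  then show "(\<mu> + ?s) / 2 * ((\<mu> - ?s) / 2) = c"
    by simp
qed

theorem mainTheorem5:
  fixes G :: "('a, 'b) pre_digraph" and arev :: "'b \<Rightarrow> 'b"
    and q n :: nat and x0 x :: 'a
    and lam :: "nat \<Rightarrow> real" and f :: "nat \<Rightarrow> 'a \<Rightarrow> complex"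
  assumes "q > 0"
    and "bidirected_digraph G arev" and "fin_digraph G"
    and "regular_graph (q + 1) G"
    and "n = card (verts G)"
    and "x0 \<in> verts G" and "x \<in> verts G"
    and "orthonormal_eigensystem G q lam f"
  shows "\<exists>r>0. \<forall>u::complex. norm u < r \<longrightarrow>
    (\<lambda>m. log_zeta_term G arev q x0 u x (Suc m)) sums Ln (graph_zeta G arev q x0 u x) \<and>
    - Ln (graph_zeta G arev q x0 u x) =
      1 / of_nat n * (\<Sum>j<n. f j x * cnj (f j x0) *
        Ln (1 - (of_nat q + 1 - of_real (lam j)) * u + of_nat q * u ^ 2))"
proof -
  interpret fin_bidirected_digraph G arev
    using assms(2,3) by (simp add: fin_bidirected_digraph_def)
  define \<mu> where "\<mu> = (\<lambda>j. of_nat q + 1 - complex_of_real (lam j))"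
  define w where "w = (\<lambda>j. f j x * cnj (f j x0))"
  define R where "R = (\<lambda>u. 1 / of_nat n * (\<Sum>j<n. w j * Ln (1 - \<mu> j * u + of_nat q * u ^ 2)))"
  have "\<forall>j. \<exists>\<alpha> \<beta>. \<alpha> + \<beta> = \<mu> j \<and> \<alpha> * \<beta> = of_nat q"
    by (meson exists_sum_product)
  then obtain \<alpha> \<beta> where ab: "\<And>j. \<alpha> j + \<beta> j = \<mu> j" "\<And>j. \<alpha> j * \<beta> j = of_nat q"
    by metis
  have count: "of_nat (geo_count G arev x0 m x) =
      1 / of_nat n * (\<Sum>j<n. w j * geo_poly q (\<mu> j) m)" for m
    using geo_count_spectral[OF assms(4,5,8,7,6)] by (simp add: w_def \<mu>_def)
  have coeff: "of_int (zeta_coeff G arev q x0 (Suc m) x) =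
      1 / of_nat n * (\<Sum>j<n. w j * (\<alpha> j ^ Suc m + \<beta> j ^ Suc m))" for m
  proof -
    let ?K = "{1..Suc m div 2}"
    have "complex_of_int (zeta_coeff G arev q x0 (Suc m) x) =
        1 / of_nat n * (\<Sum>j<n. w j * geo_poly q (\<mu> j) (Suc m)) - (of_nat q - 1) *
          (\<Sum>k\<in>?K. 1 / of_nat n * (\<Sum>j<n. w j * geo_poly q (\<mu> j) (Suc m - 2 * k)))"
      by (simp add: zeta_coeff_def count del: geo_poly.simps)
    also have "(\<Sum>k\<in>?K. 1 / of_nat n * (\<Sum>j<n. w j * geo_poly q (\<mu> j) (Suc m - 2 * k))) =
        1 / of_nat n * (\<Sum>j<n. w j * (\<Sum>k\<in>?K. geo_poly q (\<mu> j) (Suc m - 2 * k)))"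
      unfolding sum_distrib_left[symmetric] by (subst sum.swap) (simp add: sum_distrib_left)
    also have "1 / of_nat n * (\<Sum>j<n. w j * geo_poly q (\<mu> j) (Suc m)) - (of_nat q - 1) * \<dots> =
        1 / of_nat n * (\<Sum>j<n. w j * (geo_poly q (\<mu> j) (Suc m)
          - (of_nat q - 1) * (\<Sum>k\<in>?K. geo_poly q (\<mu> j) (Suc m - 2 * k))))"
      by (simp only: right_diff_distrib sum_subtractf sum_distrib_left mult_ac)
    also have "\<dots> = 1 / of_nat n * (\<Sum>j<n. w j * (\<alpha> j ^ Suc m + \<beta> j ^ Suc m))"
      using zeta_coeff_poly_eq_power_sum[OF ab, of _ "Suc m"] by simp
    finally show ?thesis .
  qed
  have series: "(\<lambda>m. log_zeta_term G arev q x0 u x (Suc m)) sums - R u"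
    if "\<forall>j<n. norm (\<alpha> j * u) < 1 \<and> norm (\<beta> j * u) < 1" for u
  proof -
    have "(\<lambda>m. 1 / of_nat n *
        (\<Sum>j<n. w j * ((\<alpha> j ^ Suc m + \<beta> j ^ Suc m) / of_nat (Suc m) * u ^ Suc m))) sums
        (1 / of_nat n * (\<Sum>j<n. w j * - Ln (1 - (\<alpha> j + \<beta> j) * u + \<alpha> j * \<beta> j * u ^ 2)))"
      using that by (intro sums_mult sums_sum power_sum_series) auto
    then show ?thesis
      unfolding log_zeta_term_def coeff R_def ab
      by (simp add: sum_distrib_left sum_distrib_right sum_divide_distrib sum_negf mult_ac
          del: power_Suc of_nat_Suc)
  qed
  \<comment> \<open>\<open>R\<close> is continuous with value 0 at 0, so near 0 its values avoid the edge of the strip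
    \<open>\<bar>Im z\<bar> < \<pi>\<close> on which \<open>Ln\<close> inverts \<open>exp\<close>.\<close>
  have "isCont R 0"
    unfolding R_def by (intro continuous_intros) auto
  then have Im_small: "\<forall>\<^sub>F u in nhds 0. \<bar>Im (R u)\<bar> < pi"
  proof -
    have "((\<lambda>u. \<bar>Im (R u)\<bar>) \<longlongrightarrow> \<bar>Im (R 0)\<bar>) (nhds 0)"
      using \<open>isCont R 0\<close> by (intro tendsto_intros) (simp add: continuous_at tendsto_nhds_iff)
    then show ?thesis
      by (rule order_tendstoD) (simp add: R_def)
  qed
  have root_small: "\<forall>\<^sub>F u in nhds 0. norm (c * u) < 1" for c :: complex
  proof -
    have "((\<lambda>u. norm (c * u)) \<longlongrightarrow> norm (c * 0)) (nhds 0)"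
      by (intro tendsto_intros filterlim_ident)
    then show ?thesis
      by (rule order_tendstoD) simp
  qed
  have "\<forall>\<^sub>F u in nhds 0. \<bar>Im (R u)\<bar> < pi \<and>
      (\<forall>j\<in>{..<n}. norm (\<alpha> j * u) < 1 \<and> norm (\<beta> j * u) < 1)"
    using Im_small root_small by (simp add: eventually_conj_iff eventually_ball_finite_distrib)
  then obtain r where r: "r > 0" "\<And>u. norm u < r \<Longrightarrow> \<bar>Im (R u)\<bar> < pi \<and>
      (\<forall>j<n. norm (\<alpha> j * u) < 1 \<and> norm (\<beta> j * u) < 1)"
    unfolding eventually_nhds_metric by (auto simp: dist_norm)
  show ?thesis
  proof (intro exI[of _ r] conjI allI impI r(1))
    fix u :: complex assume u: "norm u < r"
    have sums: "(\<lambda>m. log_zeta_term G arev q x0 u x (Suc m)) sums - R u"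
      using r(2)[OF u] by (intro series) blast
    have "Ln (graph_zeta G arev q x0 u x) = - R u"
      unfolding graph_zeta_def sums_unique[OF sums, symmetric]
      using r(2)[OF u] by (intro Ln_exp) auto
    with sums show "(\<lambda>m. log_zeta_term G arev q x0 u x (Suc m)) sums Ln (graph_zeta G arev q x0 u x)"
      and "- Ln (graph_zeta G arev q x0 u x) = 1 / of_nat n * (\<Sum>j<n. f j x * cnj (f j x0) *
        Ln (1 - (of_nat q + 1 - of_real (lam j)) * u + of_nat q * u ^ 2))"
      by (simp_all add: R_def w_def \<mu>_def)
  qed
qed

end
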